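(* Let $G$ be a finite group and let $\mathcal{Q}_G$ be the set of sections of $G$. The partial order $\leq$ on $\mathcal{Q}_G$ is a product of three relations, i.e., $${\leq} = {\leq_K} \circ {\leq_{P/K}} \circ {\leq_P}.$$ Moreover, if $A(R)$ denotes the incidence matrix of a partial order $R$ on $\mathcal{Q}_G$, the stronger property $$A(\leq) = A(\leq_K)\cdot A(\leq_{P/K})\cdot A(\leq_P)$$ also holds.
   Context: A section of a finite group $G$ is a pair $(P,K)$ of subgroups of $G$ with $K \trianglelefteq P$; $\mathcal{Q}_G$ is the set of all sections of $G$. Partial orders on $\mathcal{Q}_G$: $(P',K') \leq (P,K)$ if $P'\leq P$ and $K'\leq K$. Given $(P',K')\leq (P,K)$, write $(P',K')\leq_P (P,K)$ if $P'=P$; write $(P',K')\leq_K (P,K)$ if $K'=K$; write $(P',K')\leq_{P/K}(P,K)$ if the map $P'/K'\to P/K$, $pK'\mapsto pK$ ($p\in P'$), is an isomorphism. (The subscripts $P$, $K$, $P/K$ are just names of the relations.) The relation product of $R\subseteq X\times Y$ and $S\subseteq Y\times Z$ is $S\circ R=\{(x,z) : (x,y)\in R \text{ and } (y,z)\in S \text{ for some } y\in Y\}$. The incidence matrix of a finite poset $(X,\leq)$ is $A(\leq)=(a_{xy})_{x,y\in X}$ with $a_{xy}=1$ if $y\leq x$ and $a_{xy}=0$ otherwise. *)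

theory Defs
  imports "HOL-Algebra.Coset"
begin

definition sections :: "('a, 'b) monoid_scheme \<Rightarrow> ('a set \<times> 'a set) set" where
  "sections G =
    {(P, K). subgroup P G \<and> subgroup K G \<and> K \<lhd> G\<lparr>carrier := P\<rparr>}"

text \<open>A pair \<open>(x, y)\<close> belongs to one of the following relations iff \<open>x\<close> is less than or
  equal to \<open>y\<close>.  The product \<open>S \<circ> R\<close> of relations (first \<open>R\<close>, then \<open>S\<close>) is \<open>R O S\<close>.\<close>

definition sec_le :: "('a, 'b) monoid_scheme \<Rightarrow> ('a set \<times> 'a set) rel" where
  "sec_le G =
    {((P', K'), (P, K)). (P', K') \<in> sections G \<and> (P, K) \<in> sections G \<and> P' \<subseteq> P \<and> K' \<subseteq> K}"

definition sec_le_P :: "('a, 'b) monoid_scheme \<Rightarrow> ('a set \<times> 'a set) rel" where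
  "sec_le_P G = {((P', K'), (P, K)). ((P', K'), (P, K)) \<in> sec_le G \<and> P' = P}"

definition sec_le_K :: "('a, 'b) monoid_scheme \<Rightarrow> ('a set \<times> 'a set) rel" where
  "sec_le_K G = {((P', K'), (P, K)). ((P', K'), (P, K)) \<in> sec_le G \<and> K' = K}"

text \<open>The map \<open>pK' \<mapsto> pK\<close> on cosets is given as the function \<open>f\<close> satisfying that equation for
  all \<open>p \<in> P'\<close>; this determines \<open>f\<close> on the carrier of \<open>P'/K'\<close>, whose elements, introduced in
  the library as right cosets, are also the left cosets because \<open>K'\<close> is normal in \<open>P'\<close>.\<close>

definition sec_le_PK :: "('a, 'b) monoid_scheme \<Rightarrow> ('a set \<times> 'a set) rel" where
  "sec_le_PK G = {((P', K'), (P, K)). ((P', K'), (P, K)) \<in> sec_le G \<and>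
     (\<exists>f \<in> iso (G\<lparr>carrier := P'\<rparr> Mod K') (G\<lparr>carrier := P\<rparr> Mod K).
        \<forall>p \<in> P'. f (p <#\<^bsub>G\<^esub> K') = p <#\<^bsub>G\<^esub> K)}"

text \<open>Matrices indexed by a finite set \<open>X\<close> are functions of two arguments vanishing off
  \<open>X \<times> X\<close>.  The incidence matrix of an order on \<open>X\<close>, given as a subset of \<open>X \<times> X\<close>, is of this
  kind, with the larger element as row index.\<close>

definition incidence_matrix :: "'x rel \<Rightarrow> 'x \<Rightarrow> 'x \<Rightarrow> int" where
  "incidence_matrix R x y = (if (y, x) \<in> R then 1 else 0)"

definition matrix_prod :: "'x set \<Rightarrow> ('x \<Rightarrow> 'x \<Rightarrow> int) \<Rightarrow> ('x \<Rightarrow> 'x \<Rightarrow> int) \<Rightarrow> 'x \<Rightarrow> 'x \<Rightarrow> int" where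
  "matrix_prod X A B x z = (\<Sum>y\<in>X. A x y * B y z)"

lemma finite_sections:
  assumes "finite (carrier G)"
  shows "finite (sections G)"
proof (rule finite_subset)
  show "sections G \<subseteq> Pow (carrier G) \<times> Pow (carrier G)"
    by (auto simp: sections_def dest: subgroup.subset)
qed (use assms in auto)

lemma partial_order_sec_le: "partial_order_on (sections G) (sec_le G)"
  unfolding partial_order_on_def preorder_on_def
  by (intro conjI refl_onI transI antisymI) (auto simp: sec_le_def)

lemma partial_order_sec_le_P: "partial_order_on (sections G) (sec_le_P G)"
  unfolding partial_order_on_def preorder_on_def
  by (intro conjI refl_onI transI antisymI) (auto simp: sec_le_def sec_le_P_def)

lemma partial_order_sec_le_K: "partial_order_on (sections G) (sec_le_K G)"
  unfolding partial_order_on_def preorder_on_def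
  by (intro conjI refl_onI transI antisymI) (auto simp: sec_le_def sec_le_K_def)

lemma iso_comp: "f \<in> iso A B \<Longrightarrow> g \<in> iso B C \<Longrightarrow> g \<circ> f \<in> iso A C"
  unfolding iso_def hom_def by (auto simp: Pi_iff intro: bij_betw_trans)

lemma partial_order_sec_le_PK: "partial_order_on (sections G) (sec_le_PK G)"
proof -
  have "refl_on (sections G) (sec_le_PK G)"
    by (intro refl_onI) (auto simp: sec_le_PK_def sec_le_def intro!: bexI[of _ "\<lambda>x. x"] iso_set_refl)
  moreover have "trans (sec_le_PK G)"
  proof (rule transI)
    fix x y z assume "(x, y) \<in> sec_le_PK G" "(y, z) \<in> sec_le_PK G"
    moreover obtain P'' K'' P' K' P K where "x = (P'', K'')" "y = (P', K')" "z = (P, K)"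
      by (metis surj_pair)
    ultimately obtain f g
      where *: "((P'', K''), (P', K')) \<in> sec_le G" "((P', K'), (P, K)) \<in> sec_le G"
        and f: "f \<in> iso (G\<lparr>carrier := P''\<rparr> Mod K'') (G\<lparr>carrier := P'\<rparr> Mod K')"
          "\<forall>p\<in>P''. f (p <#\<^bsub>G\<^esub> K'') = p <#\<^bsub>G\<^esub> K'"
        and g: "g \<in> iso (G\<lparr>carrier := P'\<rparr> Mod K') (G\<lparr>carrier := P\<rparr> Mod K)"
          "\<forall>p\<in>P'. g (p <#\<^bsub>G\<^esub> K') = p <#\<^bsub>G\<^esub> K"
        and xz: "x = (P'', K'')" "z = (P, K)"
      by (auto simp: sec_le_PK_def)
    have "((P'', K''), (P, K)) \<in> sec_le G" and "P'' \<subseteq> P'"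
      using * by (auto simp: sec_le_def)
    moreover have "g \<circ> f \<in> iso (G\<lparr>carrier := P''\<rparr> Mod K'') (G\<lparr>carrier := P\<rparr> Mod K)"
      using f(1) g(1) by (rule iso_comp)
    moreover have "\<forall>p\<in>P''. (g \<circ> f) (p <#\<^bsub>G\<^esub> K'') = p <#\<^bsub>G\<^esub> K"
      using f(2) g(2) \<open>P'' \<subseteq> P'\<close> by auto
    ultimately show "(x, z) \<in> sec_le_PK G"
      unfolding xz sec_le_PK_def by (simp only: mem_Collect_eq prod.case) blast
  qed
  moreover have "antisym (sec_le_PK G)"
    by (intro antisymI) (auto simp: sec_le_PK_def sec_le_def)
  ultimately show ?thesis
    by (auto simp: partial_order_on_def preorder_on_def sec_le_PK_def sec_le_def)
qed

end

theory Submission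
  imports Defs "HOL-Algebra.SndIsomorphismGrp"
begin

text \<open>For \<open>(P', K') \<le> (P, K)\<close> the chain
  \<open>(P', K') \<le>\<^sub>P (P', K \<inter> P') \<le>\<^bsub>P/K\<^esub> (K P', K) \<le>\<^sub>K (P, K)\<close> exists by the second isomorphism
  theorem.  It is the only one of its shape: \<open>(P', L) \<le>\<^bsub>P/K\<^esub> (M, K)\<close> says that \<open>P' \<rightarrow> M/K\<close> has
  kernel \<open>L\<close> and is surjective, that is \<open>L = K \<inter> P'\<close> and \<open>M = K P'\<close>.  An entry of the matrix
  product counts such chains, so uniqueness yields the matrix identity.\<close>

lemma (in second_isomorphism_grp) iso_l_coset:
  "\<exists>f \<in> iso (G\<lparr>carrier := S\<rparr> Mod (H \<inter> S)) (G\<lparr>carrier := H <#> S\<rparr> Mod H).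
     \<forall>s\<in>S. f (s <# (H \<inter> S)) = s <# H"
proof
  \<comment> \<open>The form in which the library states the second isomorphism theorem: a coset
    \<open>X\<close> goes to the only member of \<open>{H #> g | g \<in> X}\<close>. It remains to
    compute this member for \<open>X = s <# (H \<inter> S)\<close>.\<close>
  let ?f = "\<lambda>X. the_elem ((\<lambda>g. H #> g) ` X)"
  show "?f \<in> iso (G\<lparr>carrier := S\<rparr> Mod (H \<inter> S)) (G\<lparr>carrier := H <#> S\<rparr> Mod H)"
    by (rule normal_intersection_quotient_isom)
  show "\<forall>s\<in>S. ?f (s <# (H \<inter> S)) = s <# H"
  proof
    fix s assume s: "s \<in> S"
    then have sG: "s \<in> carrier G"
      using subgrpS by (rule subgroup.mem_carrier[rotated])
    \<comment> \<open>All elements of the coset of \<open>s\<close> yield the same coset of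
      \<open>H\<close>, so the image under \<open>the_elem\<close> has at most one member; the unit
      shows that it has one.\<close>
    have "H #> (s \<otimes> k) = s <# H" if "k \<in> H" for k
    proof -
      have k: "k \<in> carrier G"
        using that by (rule mem_carrier)
      have "H #> (s \<otimes> k) = (s \<otimes> k) <# H"
        using coset_eq sG k by simp
      also have "\<dots> = s <# (k <# H)"
        using sG k subset by (simp add: lcos_m_assoc)
      also have "k <# H = H"
        using that k is_subgroup by (simp add: coset_join3)
      finally show ?thesis .
    qed
    moreover have "\<one> \<in> H \<inter> S"
      using subgrpS by (simp add: subgroup.one_closed)
    ultimately have "(\<lambda>g. H #> g) ` (s <# (H \<inter> S)) = {s <# H}"
      unfolding l_coset_def[of G s "H \<inter> S"] by blast
    then show "?f (s <# (H \<inter> S)) = s <# H"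
      by simp
  qed
qed

text \<open>Since \<open>K\<close> need not be normal in \<open>G\<close>, the second isomorphism
  theorem is applied inside \<open>P\<close>.\<close>

lemma section_second_isomorphism_grp:
  assumes "group G" "(P, K) \<in> sections G" "subgroup Q G" "Q \<subseteq> P"
  shows "second_isomorphism_grp K (G\<lparr>carrier := P\<rparr>) Q"
  using assms
  by (simp add: sections_def second_isomorphism_grp_def second_isomorphism_grp_axioms_def
      group.subgroup_incl)

lemma sec_le_PK_iff:
  fixes G (structure)
  assumes "group G"
  shows "((Q, L), (M, K)) \<in> sec_le_PK G \<longleftrightarrow>
    (Q, L) \<in> sections G \<and> (M, K) \<in> sections G \<and> L = K \<inter> Q \<and> M = K <#> Q"
    (is "?lhs \<longleftrightarrow> ?rhs")
proof
  interpret group G by fact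
  assume ?lhs
  then obtain f where QL: "(Q, L) \<in> sections G" and MK: "(M, K) \<in> sections G"
    and sub: "Q \<subseteq> M" "L \<subseteq> K"
    and f: "f \<in> iso (G\<lparr>carrier := Q\<rparr> Mod L) (G\<lparr>carrier := M\<rparr> Mod K)"
    and f_eq: "\<And>p. p \<in> Q \<Longrightarrow> f (p <# L) = p <# K"
    by (auto simp: sec_le_PK_def sec_le_def)
  interpret L: normal L "G\<lparr>carrier := Q\<rparr>"
    using QL by (simp add: sections_def)
  interpret K: normal K "G\<lparr>carrier := M\<rparr>"
    using MK by (simp add: sections_def)
  have sg: "subgroup Q G" "subgroup L G" "subgroup M G" "subgroup K G"
    using QL MK by (auto simp: sections_def)
  have Q: "p \<in> carrier G" if "p \<in> Q" for p
    using sg(1) that by (rule subgroup.mem_carrier)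
  \<comment> \<open>The carrier of a factor group is built from right cosets, while
    \<open>f_eq\<close> speaks of left ones; normality in \<open>Q\<close> and in \<open>M\<close>
    translates between them.\<close>
  have L_coset: "p <# L = L #> p" if "p \<in> Q" for p
    using L.coset_eq that by simp
  have K_coset: "p <# K = K #> p" if "p \<in> M" for p
    using K.coset_eq that by simp
  have carrier_L: "p <# L \<in> carrier (G\<lparr>carrier := Q\<rparr> Mod L)" if "p \<in> Q" for p
    using that by (simp add: carrier_FactGroup L_coset)
  have one: "\<one> \<in> Q" "\<one> <# L = L" "\<one> <# K = K"
    using sg by (simp_all add: subgroup.one_closed lcos_mult_one subgroup.subset)
  have bij: "bij_betw f (carrier (G\<lparr>carrier := Q\<rparr> Mod L)) (carrier (G\<lparr>carrier := M\<rparr> Mod K))"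
    using f by (simp add: iso_def)
  \<comment> \<open>Injectivity of \<open>f\<close>: for \<open>p\<close> in
    \<open>K \<inter> Q\<close> the cosets of \<open>p\<close> and of the unit modulo
    \<open>L\<close> are both sent to \<open>K\<close>.\<close>
  have "K \<inter> Q \<subseteq> L"
  proof
    fix p assume p: "p \<in> K \<inter> Q"
    then have "f (p <# L) = f (\<one> <# L)"
      using f_eq[of p] f_eq[OF one(1)] one sg Q[of p] by (simp add: coset_join3)
    then have "p <# L = L"
      using bij_betw_imp_inj_on[OF bij] carrier_L[of p] carrier_L[OF one(1)] p one(2)
      by (auto dest: inj_onD)
    then have "L #> p = L"
      using L_coset p by simp
    then show "p \<in> L"
      using p Q sg(2) by (auto intro: coset_join1 simp: subgroup.subset)
  qed
  moreover have "L \<subseteq> Q"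
    using L.subset by simp
  \<comment> \<open>Surjectivity of \<open>f\<close>: the coset of \<open>m\<close> modulo
    \<open>K\<close> is the image of the coset of some \<open>p\<close> in \<open>Q\<close>, so
    \<open>m\<close> lies in \<open>K #> p\<close>.\<close>
  moreover have "M \<subseteq> K <#> Q"
  proof
    fix m assume m: "m \<in> M"
    then have "K #> m \<in> f ` carrier (G\<lparr>carrier := Q\<rparr> Mod L)"
      using bij_betw_imp_surj_on[OF bij] by (simp add: carrier_FactGroup)
    then obtain p where p: "p \<in> Q" "K #> m = f (L #> p)"
      by (auto simp: carrier_FactGroup)
    then have "K #> m = K #> p"
      using f_eq L_coset K_coset sub by auto
    moreover have "m \<in> K #> m"
      using m sg by (blast intro: rcos_self subgroup.mem_carrier)
    ultimately show "m \<in> K <#> Q"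
      using p by (auto simp: r_coset_def set_mult_def)
  qed
  moreover have "K <#> Q \<subseteq> M"
    using sub K.subset sg(3) by (auto simp: set_mult_def intro!: subgroup.m_closed)
  ultimately show ?rhs
    using QL MK sub by blast
next
  assume r: ?rhs
  then have K: "subgroup K G" and Q: "subgroup Q G"
    by (auto simp: sections_def)
  interpret group G by fact
  \<comment> \<open>The inclusion demanded by \<open>sec_le\<close> is hidden in
    \<open>M = K <#> Q\<close>, because \<open>K\<close> contains the unit.\<close>
  have "Q \<subseteq> M"
  proof
    fix p assume p: "p \<in> Q"
    then have "\<one> \<otimes> p \<in> M"
      using r subgroup.one_closed[OF K] unfolding set_mult_def by blast
    moreover have "\<one> \<otimes> p = p"
      using subgroup.mem_carrier[OF Q p] by simp
    ultimately show "p \<in> M"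
      by simp
  qed
  then interpret second_isomorphism_grp K "G\<lparr>carrier := M\<rparr>" Q
    using r Q assms by (blast intro: section_second_isomorphism_grp)
  show ?lhs
    using r \<open>Q \<subseteq> M\<close> iso_l_coset by (auto simp: sec_le_PK_def sec_le_def)
qed

text \<open>This and the next lemma show that the two intermediate pairs of the chain are
  sections.\<close>

lemma sections_Int:
  assumes "group G" "(P, K) \<in> sections G" "subgroup Q G" "Q \<subseteq> P"
  shows "(Q, K \<inter> Q) \<in> sections G"
proof -
  interpret second_isomorphism_grp K "G\<lparr>carrier := P\<rparr>" Q
    using assms by (rule section_second_isomorphism_grp)
  have "subgroup (K \<inter> Q) G"
    using assms by (auto simp: sections_def intro: group.subgroups_Inter_pair)
  then show ?thesis
    using normal_subgrp_intersection_normal assms by (simp add: sections_def Int_commute)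
qed

lemma sections_set_mult:
  assumes "group G" "(P, K) \<in> sections G" "subgroup Q G" "Q \<subseteq> P"
  shows "(K <#>\<^bsub>G\<^esub> Q, K) \<in> sections G" and "K <#>\<^bsub>G\<^esub> Q \<subseteq> P"
proof -
  interpret second_isomorphism_grp K "G\<lparr>carrier := P\<rparr>" Q
    using assms by (rule section_second_isomorphism_grp)
  have sub: "subgroup (K <#>\<^bsub>G\<^esub> Q) (G\<lparr>carrier := P\<rparr>)"
    using normal_set_mult_subgroup by simp
  then show "K <#>\<^bsub>G\<^esub> Q \<subseteq> P"
    using subgroup.subset by fastforce
  have "subgroup (K <#>\<^bsub>G\<^esub> Q) G"
    using assms sub by (auto simp: sections_def intro: group.incl_subgroup)
  \<comment> \<open>Normality in \<open>P\<close> passes to the intermediate group, which contains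
    \<open>K\<close>.\<close>
  moreover have "K \<lhd> G\<lparr>carrier := K <#>\<^bsub>G\<^esub> Q\<rparr>"
    using normal_restrict_supergroup[OF sub normal_axioms] H_contained_in_set_mult by simp
  ultimately show "(K <#>\<^bsub>G\<^esub> Q, K) \<in> sections G"
    using assms by (simp add: sections_def)
qed

text \<open>With \<open>u\<close> and \<open>v\<close> left free, the equivalence gives existence of
  a chain, for the relation product, and its uniqueness, for the matrices.\<close>

lemma sec_le_chain_iff:
  assumes "group G"
  shows "((P', K'), u) \<in> sec_le_P G \<and> (u, v) \<in> sec_le_PK G \<and> (v, (P, K)) \<in> sec_le_K G \<longleftrightarrow>
    ((P', K'), (P, K)) \<in> sec_le G \<and> u = (P', K \<inter> P') \<and> v = (K <#>\<^bsub>G\<^esub> P', K)"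
    (is "?lhs \<longleftrightarrow> ?rhs")
proof
  assume l: ?lhs
  \<comment> \<open>Extracted first, since rewriting with \<open>sec_le_PK_iff\<close> leaves only
    equations; it links \<open>P'\<close> to \<open>P\<close> through \<open>fst v\<close>.\<close>
  then have "fst u \<subseteq> fst v"
    by (auto simp: sec_le_PK_def sec_le_def)
  with l show ?rhs
    by (cases u; cases v) (auto simp: sec_le_PK_iff[OF assms] sec_le_P_def sec_le_K_def sec_le_def)
next
  assume r: ?rhs
  then have PK: "(P, K) \<in> sections G" "subgroup P' G" "P' \<subseteq> P"
    by (auto simp: sec_le_def sections_def)
  \<comment> \<open>Together with \<open>K' \<subseteq> K\<close> this places \<open>K'\<close>
    below \<open>K \<inter> P'\<close>, as the first link of the chain requires.\<close>
  have "K' \<subseteq> P'"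
    using r by (auto simp: sec_le_def sections_def dest!: normal_imp_subgroup subgroup.subset)
  then show ?lhs
    using r sections_Int[OF assms PK] sections_set_mult[OF assms PK]
    by (auto simp: sec_le_PK_iff[OF assms] sec_le_P_def sec_le_K_def sec_le_def)
qed

text \<open>A product of 0/1 entries is 1 exactly when all its factors are. As the row index is the
  larger element, the leftmost factor \<open>T\<close> is the last step of the chain from
  \<open>y\<close> up to \<open>x\<close>.\<close>

lemma matrix_prod_incidence_eq_card:
  assumes "finite X"
  shows "matrix_prod X (matrix_prod X (incidence_matrix T) (incidence_matrix S))
      (incidence_matrix R) x y =
    int (card {(u, v) \<in> X \<times> X. (y, u) \<in> R \<and> (u, v) \<in> S \<and> (v, x) \<in> T})"
proof -
  have "matrix_prod X (matrix_prod X (incidence_matrix T) (incidence_matrix S))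
      (incidence_matrix R) x y =
    (\<Sum>u\<in>X. \<Sum>v\<in>X. if (y, u) \<in> R \<and> (u, v) \<in> S \<and> (v, x) \<in> T then 1 else 0)"
    unfolding matrix_prod_def incidence_matrix_def sum_distrib_right
    by (intro sum.cong) auto
  also have "\<dots> = (\<Sum>z\<in>X \<times> X. if case z of (u, v) \<Rightarrow> (y, u) \<in> R \<and> (u, v) \<in> S \<and> (v, x) \<in> T then 1 else 0)"
    by (simp add: sum.cartesian_product case_prod_beta)
  also have "\<dots> = int (card {z \<in> X \<times> X. case z of (u, v) \<Rightarrow> (y, u) \<in> R \<and> (u, v) \<in> S \<and> (v, x) \<in> T})"
    using assms by (simp add: sum.If_cases Int_def)
  also have "{z \<in> X \<times> X. case z of (u, v) \<Rightarrow> (y, u) \<in> R \<and> (u, v) \<in> S \<and> (v, x) \<in> T} =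
      {(u, v) \<in> X \<times> X. (y, u) \<in> R \<and> (u, v) \<in> S \<and> (v, x) \<in> T}"
    by auto
  finally show ?thesis .
qed

theorem corollary3p8:
  fixes G :: "('a, 'b) monoid_scheme"
  assumes "group G" and "finite (carrier G)"
  shows "sec_le G = sec_le_P G O sec_le_PK G O sec_le_K G \<and>
    incidence_matrix (sec_le G) =
      matrix_prod (sections G)
        (matrix_prod (sections G) (incidence_matrix (sec_le_K G)) (incidence_matrix (sec_le_PK G)))
        (incidence_matrix (sec_le_P G))"
proof (intro conjI ext)
  show "sec_le G = sec_le_P G O sec_le_PK G O sec_le_K G"
  proof (rule Set.set_eqI)
    fix z :: "('a set \<times> 'a set) \<times> 'a set \<times> 'a set"
    obtain P' K' P K where "z = ((P', K'), (P, K))"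
      by (metis surj_pair)
    then show "z \<in> sec_le G \<longleftrightarrow> z \<in> sec_le_P G O sec_le_PK G O sec_le_K G"
      using sec_le_chain_iff[OF assms(1), of P' K' _ _ P K] by (simp add: relcomp_unfold) blast
  qed
  fix x y :: "'a set \<times> 'a set"
  obtain P' K' P K where xy: "y = (P', K')" "x = (P, K)"
    by (metis surj_pair)
  let ?C = "{(u, v) \<in> sections G \<times> sections G.
    (y, u) \<in> sec_le_P G \<and> (u, v) \<in> sec_le_PK G \<and> (v, x) \<in> sec_le_K G}"
  \<comment> \<open>\<open>sec_le_PK\<close> relates only sections, so summing over
    \<open>sections G\<close> captures every chain.\<close>
  have "?C = {(u, v). (y, u) \<in> sec_le_P G \<and> (u, v) \<in> sec_le_PK G \<and> (v, x) \<in> sec_le_K G}"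
    by (auto simp: sec_le_PK_def sec_le_def)
  \<comment> \<open>The chains form a singleton or the empty set, so their number is the incidence
    entry itself.\<close>
  also have "\<dots> = (if (y, x) \<in> sec_le G then {((P', K \<inter> P'), (K <#>\<^bsub>G\<^esub> P', K))} else {})"
    unfolding xy sec_le_chain_iff[OF assms(1)] by auto
  finally have "int (card ?C) = incidence_matrix (sec_le G) x y"
    by (simp add: incidence_matrix_def)
  then show "incidence_matrix (sec_le G) x y =
      matrix_prod (sections G)
        (matrix_prod (sections G) (incidence_matrix (sec_le_K G)) (incidence_matrix (sec_le_PK G)))
        (incidence_matrix (sec_le_P G)) x y"
    by (simp add: matrix_prod_incidence_eq_card finite_sections assms(2))
qed

end
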